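(* Let $n\ge2$, $\rho>0$, and consider the path planning problem for a Reeds-Shepp vehicle with minimum turning radius $\rho$ visiting $n$ waypoints in the given sequence $(s_1,\dots,s_n)$, where the orientation at waypoint $s_i$ must lie in $I_{s_i}=[\theta_{s_i}^{min},\theta_{s_i}^{max}]$ with $\theta_{s_i}^{min}<\theta_{s_i}^{max}$. For any integer $k\ge1$, the length $Cost_{lb}$ of the path computed in the lower bounding step of the algorithm $Approx$ (with $k$ intervals per waypoint) is a lower bound on the optimal length of the path planning problem.
   Context: Reeds-Shepp paths: trajectories of $\dot x=u_1\cos\theta$, $\dot y=u_1\sin\theta$, $\dot\theta=u_2$ with $u_1\in\{-1,+1\}$, $u_2\in[-\frac1\rho,\frac1\rho]$; the length of a path equals its duration; orientations are modulo $2\pi$. Waypoint $i$ is located at $(x_i,y_i)\in\mathbb{R}^2$. For orientations $\theta_i,\theta_j$, $d_{ij}(\theta_i,\theta_j)$ is the length of the shortest Reeds-Shepp path from $(x_i,y_i,\theta_i)$ to $(x_j,y_j,\theta_j)$. Path planning problem (sequence given): find $\theta_{s_i}\in I_{s_i}$, $i=1,\dots,n$, minimizing $\sum_{i=1}^{n-1}d_{s_is_{i+1}}(\theta_{s_i},\theta_{s_{i+1}})$. Lower bounding step of $Approx$: for each waypoint $i$, partition $I_i$ into $k$ intervals $[\phi_{i(j-1)},\phi_{ij}]$, $j=1,\dots,k$, where $\phi_{ij}=\theta_i^{min}+\frac{j}{k}(\theta_i^{max}-\theta_i^{min})$. Form a graph with nodes $v_{im}$ ($i=1,\dots,n$, $m=1,\dots,k$),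 where $v_{im}$ represents waypoint $s_i$ with interval $[\phi_{s_i(m-1)},\phi_{s_im}]$. There is an edge from $v_{im}$ to $v_{(i+1)l}$ for all $i=1,\dots,n-1$ and all $m,l$, with $cost(v_{im},v_{(i+1)l})=\min d_{s_is_{i+1}}(\theta,\theta')$ over $\theta\in[\phi_{s_i(m-1)},\phi_{s_im}]$ and $\theta'\in[\phi_{s_{i+1}(l-1)},\phi_{s_{i+1}l}]$. Then $Cost_{lb}$ is the minimum of $\sum_{i=1}^{n-1}cost(v_{im_i},v_{(i+1)m_{i+1}})$ over all paths $(v_{1m_1},\dots,v_{nm_n})$ from a node in $\{v_{1m}\}$ to a node in $\{v_{nm}\}$. *)

theory Defs
  imports "HOL-Analysis.Analysis" "HOL-Library.Real_Mod"
begin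

(* A trajectory on {0..T} is a Caratheodory solution of the control system for measurable
   controls u1, u2, i.e. the system is required in integrated form.  The heading th is a
   real-valued lift; it is never reduced modulo 2 * pi. *)
definition rs_trajectory ::
  "real \<Rightarrow> real \<Rightarrow> (real \<Rightarrow> real) \<Rightarrow> (real \<Rightarrow> real) \<Rightarrow> (real \<Rightarrow> real) \<Rightarrow> bool" where
  "rs_trajectory \<rho> T x y th \<longleftrightarrow>
     (\<exists>u1 u2 :: real \<Rightarrow> real.
        u1 \<in> borel_measurable (lebesgue_on {0..T}) \<and>
        u2 \<in> borel_measurable (lebesgue_on {0..T}) \<and>
        (\<forall>t\<in>{0..T}. u1 t \<in> {-1, 1} \<and> u2 t \<in> {-(1 / \<rho>)..1 / \<rho>}) \<and>
        (\<forall>t\<in>{0..T}.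
           ((\<lambda>\<tau>. u1 \<tau> * cos (th \<tau>)) has_integral (x t - x 0)) {0..t} \<and>
           ((\<lambda>\<tau>. u1 \<tau> * sin (th \<tau>)) has_integral (y t - y 0)) {0..t} \<and>
           (u2 has_integral (th t - th 0)) {0..t}))"

(* A configuration is (x, y, orientation); orientations are compared modulo 2 * pi. *)
type_synonym config = "real \<times> real \<times> real"

definition same_config :: "config \<Rightarrow> config \<Rightarrow> bool" where
  "same_config p q \<longleftrightarrow>
     fst p = fst q \<and> fst (snd p) = fst (snd q) \<and> [snd (snd p) = snd (snd q)] (rmod 2 * pi)"

(* T is both the duration and the length of the path. *)
definition rs_path_of_length :: "real \<Rightarrow> config \<Rightarrow> config \<Rightarrow> real \<Rightarrow> bool" where
  "rs_path_of_length \<rho> p q T \<longleftrightarrow>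
     0 \<le> T \<and>
     (\<exists>x y th. rs_trajectory \<rho> T x y th \<and>
        same_config (x 0, y 0, th 0) p \<and> same_config (x T, y T, th T) q)"

(* Length of a shortest path, as an infimum in the extended reals: it agrees with the
   minimum whenever a shortest path exists (rs_dist_eq_shortest below), and would be
   infinite if q could not be reached from p. *)
definition rs_dist :: "real \<Rightarrow> config \<Rightarrow> config \<Rightarrow> ereal" where
  "rs_dist \<rho> p q = (INF T\<in>{T. rs_path_of_length \<rho> p q T}. ereal T)"

lemma rs_dist_eq_shortest:
  assumes "rs_path_of_length \<rho> p q L"
    and "\<And>T. rs_path_of_length \<rho> p q T \<Longrightarrow> L \<le> T"
  shows "rs_dist \<rho> p q = ereal L"
  unfolding rs_dist_def
  by (rule antisym) (auto intro!: INF_lower2[of L] INF_greatest simp: assms)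

definition waypoint_dist ::
  "real \<Rightarrow> (nat \<Rightarrow> real) \<Rightarrow> (nat \<Rightarrow> real) \<Rightarrow> nat \<Rightarrow> nat \<Rightarrow> real \<Rightarrow> real \<Rightarrow> ereal" where
  "waypoint_dist \<rho> x y i j \<theta> \<theta>' = rs_dist \<rho> (x i, y i, \<theta>) (x j, y j, \<theta>')"

(* Waypoints and positions in the visiting order are numbered from 1 to n; s i is the waypoint
   visited at position i, and {lo i..hi i} is the set of admissible orientations at waypoint i. *)
definition tour_length ::
  "real \<Rightarrow> (nat \<Rightarrow> real) \<Rightarrow> (nat \<Rightarrow> real) \<Rightarrow> nat \<Rightarrow> (nat \<Rightarrow> nat) \<Rightarrow> (nat \<Rightarrow> real) \<Rightarrow> ereal" where
  "tour_length \<rho> x y n s \<theta> =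
     (\<Sum>i = 1..n - 1. waypoint_dist \<rho> x y (s i) (s (i + 1)) (\<theta> (s i)) (\<theta> (s (i + 1))))"

definition feasible_orientations ::
  "nat \<Rightarrow> (nat \<Rightarrow> nat) \<Rightarrow> (nat \<Rightarrow> real) \<Rightarrow> (nat \<Rightarrow> real) \<Rightarrow> (nat \<Rightarrow> real) set" where
  "feasible_orientations n s lo hi = {\<theta>. \<forall>i\<in>{1..n}. \<theta> (s i) \<in> {lo (s i)..hi (s i)}}"

definition optimal_length ::
  "real \<Rightarrow> (nat \<Rightarrow> real) \<Rightarrow> (nat \<Rightarrow> real) \<Rightarrow> nat \<Rightarrow> (nat \<Rightarrow> nat) \<Rightarrow>
   (nat \<Rightarrow> real) \<Rightarrow> (nat \<Rightarrow> real) \<Rightarrow> ereal" where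
  "optimal_length \<rho> x y n s lo hi =
     (INF \<theta>\<in>feasible_orientations n s lo hi. tour_length \<rho> x y n s \<theta>)"

lemma optimal_length_eq_minimum:
  assumes "\<theta> \<in> feasible_orientations n s lo hi"
    and "\<And>\<theta>'. \<theta>' \<in> feasible_orientations n s lo hi \<Longrightarrow>
      tour_length \<rho> x y n s \<theta> \<le> tour_length \<rho> x y n s \<theta>'"
  shows "optimal_length \<rho> x y n s lo hi = tour_length \<rho> x y n s \<theta>"
  unfolding optimal_length_def
  by (rule antisym) (auto intro!: INF_lower INF_greatest assms)

definition breakpoint :: "(nat \<Rightarrow> real) \<Rightarrow> (nat \<Rightarrow> real) \<Rightarrow> nat \<Rightarrow> nat \<Rightarrow> nat \<Rightarrow> real" where
  "breakpoint lo hi k i j = lo i + real j / real k * (hi i - lo i)"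

definition subinterval :: "(nat \<Rightarrow> real) \<Rightarrow> (nat \<Rightarrow> real) \<Rightarrow> nat \<Rightarrow> nat \<Rightarrow> nat \<Rightarrow> real set" where
  "subinterval lo hi k i m = {breakpoint lo hi k i (m - 1)..breakpoint lo hi k i m}"

(* The node (i, m) is position i of the sequence together with the m-th subinterval of the
   admissible orientations at waypoint s i. *)
type_synonym node = "nat \<times> nat"

definition lb_edges :: "nat \<Rightarrow> nat \<Rightarrow> (node \<times> node) set" where
  "lb_edges n k = {((i, m), (i + 1, l)) | i m l. i \<in> {1..n - 1} \<and> m \<in> {1..k} \<and> l \<in> {1..k}}"

definition edge_cost ::
  "real \<Rightarrow> (nat \<Rightarrow> real) \<Rightarrow> (nat \<Rightarrow> real) \<Rightarrow> (nat \<Rightarrow> nat) \<Rightarrow> (nat \<Rightarrow> real) \<Rightarrow> (nat \<Rightarrow> real) \<Rightarrow> nat \<Rightarrow>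
   node \<Rightarrow> node \<Rightarrow> ereal" where
  "edge_cost \<rho> x y s lo hi k v w =
     (INF (\<theta>, \<theta>')\<in>subinterval lo hi k (s (fst v)) (snd v) \<times> subinterval lo hi k (s (fst w)) (snd w).
        waypoint_dist \<rho> x y (s (fst v)) (s (fst w)) \<theta> \<theta>')"

definition lb_paths :: "nat \<Rightarrow> nat \<Rightarrow> node list set" where
  "lb_paths n k =
     {p. p \<noteq> [] \<and> hd p \<in> {1} \<times> {1..k} \<and> last p \<in> {n} \<times> {1..k} \<and>
         successively (\<lambda>v w. (v, w) \<in> lb_edges n k) p}"

definition lb_path_cost ::
  "real \<Rightarrow> (nat \<Rightarrow> real) \<Rightarrow> (nat \<Rightarrow> real) \<Rightarrow> (nat \<Rightarrow> nat) \<Rightarrow> (nat \<Rightarrow> real) \<Rightarrow> (nat \<Rightarrow> real) \<Rightarrow> nat \<Rightarrow>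
   node list \<Rightarrow> ereal" where
  "lb_path_cost \<rho> x y s lo hi k p =
     (\<Sum>j < length p - 1. edge_cost \<rho> x y s lo hi k (p ! j) (p ! (j + 1)))"

definition Cost_lb ::
  "real \<Rightarrow> (nat \<Rightarrow> real) \<Rightarrow> (nat \<Rightarrow> real) \<Rightarrow> nat \<Rightarrow> (nat \<Rightarrow> nat) \<Rightarrow>
   (nat \<Rightarrow> real) \<Rightarrow> (nat \<Rightarrow> real) \<Rightarrow> nat \<Rightarrow> ereal" where
  "Cost_lb \<rho> x y n s lo hi k = Min (lb_path_cost \<rho> x y s lo hi k ` lb_paths n k)"

end

(* Every feasible choice of orientations picks a node at each position, namely a subinterval
   containing the chosen orientation.  These nodes form a path in the graph, and each edge cost
   is an infimum over a set of pairs that contains the chosen one. *)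
theory Submission
  imports Defs
begin

text \<open>Induction on \<open>k\<close>: compare \<open>t\<close> with \<open>b k\<close>. If
  \<open>t \<le> b k\<close>, the induction hypothesis supplies the interval; otherwise
  \<open>t\<close> lies in the new last one.\<close>

lemma atLeastAtMost_consecutive_cover:
  fixes b :: "nat \<Rightarrow> 'a::linorder"
  assumes "1 \<le> k" "t \<in> {b 0..b k}"
  obtains m where "m \<in> {1..k}" "t \<in> {b (m - 1)..b m}"
proof -
  have "\<exists>m\<in>{1..k}. t \<in> {b (m - 1)..b m}"
    using assms
  proof (induction k rule: nat_induct_at_least)
    case base
    then show ?case by auto
  next
    case (Suc k)
    show ?case
    proof (cases "t \<le> b k")
      case True
      with Suc obtain m where "m \<in> {1..k}" "t \<in> {b (m - 1)..b m}" by auto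
      then show ?thesis by force
    next
      case False
      with Suc.prems show ?thesis by (intro bexI[of _ "Suc k"]) auto
    qed
  qed
  with that show thesis by blast
qed

lemma subinterval_cover:
  assumes "k \<ge> 1" "t \<in> {lo i..hi i}"
  obtains m where "m \<in> {1..k}" "t \<in> subinterval lo hi k i m"
proof -
  \<comment> \<open>\<open>1 \<le> k\<close> gives \<open>real k / real k = 1\<close>; at
    \<open>k = 0\<close> this quotient would be 0 and the last breakpoint would be
    \<open>lo i\<close>.\<close>
  have "breakpoint lo hi k i 0 = lo i" "breakpoint lo hi k i k = hi i"
    using assms(1) by (auto simp: breakpoint_def)
  with assms that show thesis
    using atLeastAtMost_consecutive_cover[of k t "breakpoint lo hi k i"]
    unfolding subinterval_def by metis
qed

text \<open>A path starts at position 1 and every edge raises the position by exactly one. List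
  indices start at 0, hence the \<open>Suc j\<close>.\<close>

lemma lb_paths_nth:
  assumes "p \<in> lb_paths n k" "j < length p"
  shows "p ! j \<in> {Suc j} \<times> {1..k}"
  using assms(2)
proof (induction j)
  case 0
  then show ?case using assms(1) by (auto simp: lb_paths_def hd_conv_nth)
next
  case (Suc j)
  have "(p ! j, p ! Suc j) \<in> lb_edges n k"
    using assms(1) Suc.prems by (auto simp: lb_paths_def successively_conv_nth)
  with Suc show ?case by (auto simp: lb_edges_def)
qed

lemma length_lb_paths:
  assumes "p \<in> lb_paths n k"
  shows "length p = n"
proof -
  have "p \<noteq> []" "fst (last p) = n"
    using assms by (auto simp: lb_paths_def)
  moreover from this(1) have "fst (p ! (length p - 1)) = Suc (length p - 1)"
    using lb_paths_nth[OF assms, of "length p - 1"] by auto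
  ultimately show ?thesis by (simp add: last_conv_nth)
qed

text \<open>Makes the \<open>Min\<close> in \<open>Cost_lb\<close> a genuine lower bound of the path
  costs: all paths have length \<open>n\<close> over a finite set of nodes.\<close>

lemma finite_lb_paths: "finite (lb_paths n k)"
proof (rule finite_subset)
  show "lb_paths n k \<subseteq> {p. set p \<subseteq> {1..n} \<times> {1..k} \<and> length p = n}"
    using lb_paths_nth length_lb_paths by (fastforce simp: in_set_conv_nth)
  show "finite {p :: node list. set p \<subseteq> {1..n} \<times> {1..k} \<and> length p = n}"
    by (intro finite_lists_length_eq) auto
qed

lemma map_node_in_lb_paths:
  assumes "n \<ge> 1" "\<And>i. i \<in> {1..n} \<Longrightarrow> m i \<in> {1..k}"
  shows "map (\<lambda>i. (i, m i)) [1..<Suc n] \<in> lb_paths n k"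
proof -
  \<comment> \<open>\<open>upt_Suc\<close> is kept out of the simplifier so that
    \<open>[1..<Suc n]\<close> is not split into \<open>[1..<n] @ [n]\<close> and can be indexed
    directly.\<close>
  have "hd [1..<Suc n] = 1" "last [1..<Suc n] = n" "[1..<Suc n] \<noteq> []"
    using assms(1) by (auto simp: hd_conv_nth simp del: upt_Suc)
  moreover have "((i, m i), (Suc i, m (Suc i))) \<in> lb_edges n k" if "i \<in> {1..<n}" for i
    using that assms(2) by (auto simp: lb_edges_def)
  ultimately show ?thesis
    using assms
    by (auto simp: lb_paths_def hd_map last_map successively_conv_nth simp del: upt_Suc)
qed

text \<open>Passes from list indices, which start at 0, to tour positions, which start at 1, so that
  the path cost can be compared with \<open>tour_length\<close> term by term.\<close>

lemma lb_path_cost_map_node: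
  "lb_path_cost \<rho> x y s lo hi k (map (\<lambda>i. (i, m i)) [1..<Suc n]) =
   (\<Sum>i = 1..n - 1. edge_cost \<rho> x y s lo hi k (i, m i) (i + 1, m (i + 1)))"
proof -
  have "(\<Sum>i = 1..n - 1. edge_cost \<rho> x y s lo hi k (i, m i) (i + 1, m (i + 1))) =
    (\<Sum>j < n - 1. edge_cost \<rho> x y s lo hi k (Suc j, m (Suc j)) (Suc j + 1, m (Suc j + 1)))"
    by (rule sum.reindex_bij_witness[of _ Suc "\<lambda>i. i - 1"]) auto
  also have "\<dots> = lb_path_cost \<rho> x y s lo hi k (map (\<lambda>i. (i, m i)) [1..<Suc n])"
    unfolding lb_path_cost_def by (intro sum.cong) (auto simp del: upt_Suc)
  finally show ?thesis by simp
qed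

lemma Cost_lb_le_tour_length:
  assumes "n \<ge> 1" "k \<ge> 1" "\<theta> \<in> feasible_orientations n s lo hi"
  shows "Cost_lb \<rho> x y n s lo hi k \<le> tour_length \<rho> x y n s \<theta>"
proof -
  have "\<exists>m\<in>{1..k}. \<theta> (s i) \<in> subinterval lo hi k (s i) m" if "i \<in> {1..n}" for i
    using assms that subinterval_cover[of k "\<theta> (s i)" lo "s i" hi]
    unfolding feasible_orientations_def by blast
  \<comment> \<open>An orientation at an interior breakpoint lies in two subintervals, so
    \<open>m\<close> is a choice. It depends on the position alone, so the edges into and out of a
    position share a node.\<close>
  then obtain m where m: "\<And>i. i \<in> {1..n} \<Longrightarrow> m i \<in> {1..k}"
      "\<And>i. i \<in> {1..n} \<Longrightarrow> \<theta> (s i) \<in> subinterval lo hi k (s i) (m i)"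
    by metis
  have "Cost_lb \<rho> x y n s lo hi k \<le>
      lb_path_cost \<rho> x y s lo hi k (map (\<lambda>i. (i, m i)) [1..<Suc n])"
    unfolding Cost_lb_def using assms(1) m(1)
    by (intro Min_le finite_imageI finite_lb_paths imageI map_node_in_lb_paths)
  also have "\<dots> \<le> tour_length \<rho> x y n s \<theta>"
    unfolding lb_path_cost_map_node tour_length_def
  proof (rule sum_mono)
    fix i assume "i \<in> {1..n - 1}"
    then have "i \<in> {1..n}" "i + 1 \<in> {1..n}" by auto
    then show "edge_cost \<rho> x y s lo hi k (i, m i) (i + 1, m (i + 1)) \<le>
        waypoint_dist \<rho> x y (s i) (s (i + 1)) (\<theta> (s i)) (\<theta> (s (i + 1)))"
      unfolding edge_cost_def using m(2)
      by (intro INF_lower2[of "(\<theta> (s i), \<theta> (s (i + 1)))"]) auto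
  qed
  finally show ?thesis .
qed

theorem lemma4:
  fixes n k :: nat and \<rho> :: real and x y lo hi :: "nat \<Rightarrow> real" and s :: "nat \<Rightarrow> nat"
  assumes "n \<ge> 2" and "\<rho> > 0" and "k \<ge> 1"
    and "bij_betw s {1..n} {1..n}"
    and "\<And>i. i \<in> {1..n} \<Longrightarrow> lo (s i) < hi (s i)"
  shows "Cost_lb \<rho> x y n s lo hi k \<le> optimal_length \<rho> x y n s lo hi"
  \<comment> \<open>A bound valid for each feasible choice of orientations passes to the infimum,
    attained or not.\<close>
  unfolding optimal_length_def
  using assms(1,3) by (intro INF_greatest Cost_lb_le_tour_length) auto

end
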